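(* Let $\mathcal{H}$ be a separable infinite-dimensional Hilbert space. Suppose that $T,S_1,S_2,\ldots\in\mathcal{B}(\mathcal{H})$, $P\in\operatorname{Lat}(T)$ and $P_n\in\operatorname{Lat}(S_n)$ for $n\geq1$ are such that (1) $T$ is bounded from below, (2) $\|S_n-T\|\to0$, and (3) $P_n\to P$ in the strong operator topology. Then $$\operatorname{ind}(T,P)\leq\liminf_{n\to\infty}\operatorname{ind}(S_n,P_n).$$
   Context: $\operatorname{Lat}(T)$ is the set of closed subspaces invariant under $T\in\mathcal{B}(\mathcal{H})$, each identified with the orthogonal projection onto it; equivalently, the set of orthogonal projections $P$ with $(1-P)TP=0$. $T$ is bounded from below if $\operatorname{Ker}T=\{0\}$ and $T(\mathcal{H})$ is closed. For $P\in\operatorname{Lat}(T)$, the index of $T$ relative to $P$ is $$\operatorname{ind}(T,P)=\dim\bigl(P(\mathcal{H})\ominus\operatorname{clos}TP(\mathcal{H})\bigr)\in\{0,1,2,\ldots\}\cup\{\infty\},$$ where $\ominus$ denotes orthogonal complement of the second space in the first. *)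

theory Defs
  imports "HOL-Analysis.Analysis"
begin

section \<open>Complex Hilbert spaces\<close>

text \<open>
  The libraries only provide real inner product spaces.  A complex inner product space is a
  real one with a compatible complex scalar multiplication and a Hermitian form, linear in the
  first argument, whose real part is the given real inner product.  In particular
  \<open>cinner x x = (norm x)\<^sup>2\<close> (see \<open>cinner_self\<close> below), so positive definiteness,
  norm and topology are inherited from the class \<^class>\<open>real_inner\<close>.
\<close>

class complex_inner = real_inner +
  fixes scaleC :: "complex \<Rightarrow> 'a \<Rightarrow> 'a"  (infixr \<open>*\<^sub>C\<close> 75)
    and cinner :: "'a \<Rightarrow> 'a \<Rightarrow> complex"
  assumes scaleC_add_right: "c *\<^sub>C (x + y) = c *\<^sub>C x + c *\<^sub>C y"
    and scaleC_add_left: "(c + d) *\<^sub>C x = c *\<^sub>C x + d *\<^sub>C x"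
    and scaleC_scaleC: "c *\<^sub>C d *\<^sub>C x = (c * d) *\<^sub>C x"
    and scaleC_of_real: "complex_of_real r *\<^sub>C x = r *\<^sub>R x"
    and cinner_add_left: "cinner (x + y) z = cinner x z + cinner y z"
    and cinner_scaleC_left: "cinner (c *\<^sub>C x) y = c * cinner x y"
    and cinner_commute: "cinner x y = cnj (cinner y x)"
    and Re_cinner: "Re (cinner x y) = inner x y"

class complex_hilbert = complex_inner + complete_space

lemma cinner_self: "cinner x x = complex_of_real ((norm x)\<^sup>2)"
proof (rule complex_eqI)
  show "Re (cinner x x) = Re (complex_of_real ((norm x)\<^sup>2))"
    by (simp add: Re_cinner power2_norm_eq_inner)
  show "Im (cinner x x) = Im (complex_of_real ((norm x)\<^sup>2))"
    using arg_cong[OF cinner_commute[of x x], of Im] by simp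
qed

instantiation complex :: complex_hilbert
begin

definition scaleC_complex :: "complex \<Rightarrow> complex \<Rightarrow> complex"
  where "scaleC_complex c x = c * x"

definition cinner_complex :: "complex \<Rightarrow> complex \<Rightarrow> complex"
  where "cinner_complex x y = x * cnj y"

instance
  by standard
    (auto simp: scaleC_complex_def cinner_complex_def inner_complex_def algebra_simps scaleR_conv_of_real)

end

global_interpretation complex_vector:
  vector_space "scaleC :: complex \<Rightarrow> 'a \<Rightarrow> 'a::complex_inner"
  defines cspan = complex_vector.span
    and cdim = complex_vector.dim
proof unfold_locales
  show "1 *\<^sub>C x = x" for x :: 'a
    using scaleC_of_real[of 1 x] by simp
qed (rule scaleC_add_right scaleC_add_left scaleC_scaleC)+

text \<open>
  The library's \<open>dim\<close> is \<open>0\<close> on infinite-dimensional spaces; here the dimension takes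
  the value \<open>\<infinity>\<close> there.  All infinite dimensions are identified, so there is no
  difference between the algebraic and the Hilbert space dimension of a closed subspace.
\<close>

definition hdim :: "'a::complex_inner set \<Rightarrow> enat"
  where "hdim M = (if \<exists>B. finite B \<and> M \<subseteq> cspan B then enat (cdim M) else \<infinity>)"

definition ominus :: "'a::complex_inner set \<Rightarrow> 'a set \<Rightarrow> 'a set"  (infixl \<open>\<ominus>\<close> 65)
  where "M \<ominus> N = {x \<in> M. \<forall>y\<in>N. cinner x y = 0}"


section \<open>Operators\<close>

definition bounded_clinear :: "('a::complex_inner \<Rightarrow> 'b::complex_inner) \<Rightarrow> bool"
  where "bounded_clinear T \<longleftrightarrow> bounded_linear T \<and> (\<forall>c x. T (c *\<^sub>C x) = c *\<^sub>C T x)"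

definition orthogonal_projection :: "('a::complex_inner \<Rightarrow> 'a) \<Rightarrow> bool"
  where "orthogonal_projection P \<longleftrightarrow>
    bounded_clinear P \<and> (\<forall>x. P (P x) = P x) \<and> (\<forall>x y. cinner (P x) y = cinner x (P y))"

text \<open>Invariant subspaces are represented by their orthogonal projections: \<open>(1 - P) T P = 0\<close>.\<close>

definition Lat :: "('a::complex_inner \<Rightarrow> 'a) \<Rightarrow> ('a \<Rightarrow> 'a) set"
  where "Lat T = {P. orthogonal_projection P \<and> (\<forall>x. T (P x) - P (T (P x)) = 0)}"

lemma Lat_iff_invariant_range:
  "P \<in> Lat T \<longleftrightarrow> orthogonal_projection P \<and> T ` range P \<subseteq> range P"
proof -
  have "(\<forall>x. T (P x) - P (T (P x)) = 0) \<longleftrightarrow> T ` range P \<subseteq> range P"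
    if "orthogonal_projection P"
  proof -
    have *: "y \<in> range P \<longleftrightarrow> P y = y" for y
      using that unfolding orthogonal_projection_def by (metis rangeE rangeI)
    have "T (P x) - P (T (P x)) = 0 \<longleftrightarrow> T (P x) \<in> range P" for x
      unfolding * by auto
    then show ?thesis by blast
  qed
  then show ?thesis by (auto simp: Lat_def)
qed

definition bounded_from_below :: "('a::complex_inner \<Rightarrow> 'b::complex_inner) \<Rightarrow> bool"
  where "bounded_from_below T \<longleftrightarrow> {x. T x = 0} = {0} \<and> closed (range T)"

definition ind :: "('a::complex_inner \<Rightarrow> 'a) \<Rightarrow> ('a \<Rightarrow> 'a) \<Rightarrow> enat"
  where "ind T P = hdim (range P \<ominus> closure (T ` range P))"

end

theory Submission
  imports Defs
begin

text \<open>
  Suppose that \<open>B\<close> is a linearly independent set of \<open>k\<close> vectors in the orthogonal complement of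
  \<open>TP(H)\<close> in \<open>P(H)\<close>, and that \<open>ind (S n) (Q n) < k\<close> along a subsequence.  Counting dimensions, some
  combination \<open>v n\<close> of \<open>B\<close>, with coefficients of total modulus \<open>1\<close>, has \<open>Q n (v n)\<close> in the closure
  of \<open>S n (Q n (H))\<close>.  By compactness the coefficients converge along a further subsequence; so
  \<open>v n\<close> tends to some \<open>f\<close> in the span of \<open>B\<close>, hence \<open>Q n (v n)\<close> tends to \<open>P f = f\<close>, and there are
  \<open>u n\<close> in the range of \<open>Q n\<close> with \<open>S n (u n)\<close> tending to \<open>f\<close>.  Since \<open>T\<close> is bounded below and \<open>S n\<close>
  tends to \<open>T\<close> in norm, \<open>u n\<close> is bounded, then Cauchy, and its limit \<open>g\<close> satisfies \<open>P g = g\<close> and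
  \<open>T g = f\<close>.  Thus \<open>f\<close> is orthogonal to itself, so \<open>f = 0\<close> and all limit coefficients vanish, although
  their total modulus is \<open>1\<close>.
\<close>

instance complex_hilbert \<subseteq> banach ..

section \<open>Lower bounds for injective operators with closed range\<close>

text \<open>This is the Baire category half of the open mapping theorem. The closed range is a
  complete metric space covered by the closures of the images of balls, so one of these closures has
  interior relative to the range. Differences of approximate preimages move that interior to the
  origin, and scaling makes the estimate uniform.\<close>

lemma approximate_preimage_of_closed_range:
  fixes T :: "'a::real_normed_vector \<Rightarrow> 'b::{real_normed_vector,complete_space}"
  assumes T: "bounded_linear T" and cl: "closed (range T)"
  obtains C where "C > 0"
    and "\<And>z. z \<in> range T \<Longrightarrow> \<exists>x. norm x \<le> C * norm z \<and> norm (z - T x) \<le> norm z / 2"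
proof -
  interpret T: bounded_linear T by fact
  define X where "X = top_of_set (range T)"
  define A where "A n = closure (T ` cball 0 (real n))" for n :: nat
  have AR: "A n \<subseteq> range T" for n
    unfolding A_def by (rule closure_minimal[OF _ cl]) auto
  have Un: "\<Union>(range A) = range T"
  proof
    show "range T \<subseteq> \<Union>(range A)"
    proof
      fix y assume "y \<in> range T"
      then obtain x where x: "y = T x" by auto
      obtain n where "norm x \<le> real n" using real_arch_simple by blast
      then have "y \<in> T ` cball 0 (real n)" using x by auto
      then have "y \<in> A n" unfolding A_def by (rule subsetD[OF closure_subset])
      then show "y \<in> \<Union>(range A)" by (rule UN_I[OF UNIV_I])
    qed
  qed (use AR in blast)
  have cm: "completely_metrizable_space X"
    unfolding X_def
    by (rule completely_metrizable_space_closedin)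
      (use cl in \<open>auto simp: completely_metrizable_space_euclidean\<close>)
  have "\<exists>n. X interior_of (A n) \<noteq> {}"
  proof (rule ccontr)
    assume "\<not> ?thesis"
    moreover have "closedin X (A n)" for n
      unfolding X_def using AR[of n] by (auto simp: A_def closed_subset)
    ultimately have "X interior_of \<Union>(range A) = {}"
      using cm by (intro Baire_category_alt) auto
    moreover have "X interior_of (range T) = range T"
      unfolding X_def by (metis interior_of_topspace topspace_euclidean_subtopology)
    ultimately show False using Un by auto
  qed
  then obtain n y0 where y0: "y0 \<in> X interior_of (A n)" by auto
  then obtain e where e: "e > 0" and e_sub: "\<And>y. y \<in> range T \<Longrightarrow> dist y y0 < e \<Longrightarrow> y \<in> A n"
    and y0T: "y0 \<in> range T"
    unfolding X_def interior_of_def openin_euclidean_subtopology_iff by blast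
  \<comment> \<open>Recentring at 0: both \<open>y0 + z\<close> and \<open>y0\<close> lie in
    \<open>A n\<close>, so the difference of their approximate preimages serves for
    \<open>z\<close>, at the cost of doubling the radius.\<close>
  have approx: "\<exists>x. norm x \<le> 2 * real n \<and> norm (z - T x) < d"
    if z: "z \<in> range T" "norm z < e" and d: "d > 0" for z d
  proof -
    have "y0 + z \<in> range T"
      using y0T z by (auto simp flip: T.add)
    then have A: "y0 + z \<in> A n" "y0 \<in> A n"
      using e_sub z e y0T by (auto simp: dist_norm)
    have near: "\<exists>x. norm x \<le> real n \<and> dist (T x) y < d / 2" if "y \<in> A n" for y
    proof -
      have "\<exists>v\<in>T ` cball 0 (real n). dist v y < d / 2"
        using that half_gt_zero[OF d] unfolding A_def closure_approachable by blast
      then show ?thesis by auto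
    qed
    obtain x x' where x: "norm x \<le> real n" "dist (T x) (y0 + z) < d / 2"
      and x': "norm x' \<le> real n" "dist (T x') y0 < d / 2"
      using near[OF A(1)] near[OF A(2)] by blast
    have "norm (z - T (x - x')) = norm ((T x' - y0) - (T x - (y0 + z)))"
      by (simp add: T.diff algebra_simps)
    also have "\<dots> \<le> norm (T x' - y0) + norm (T x - (y0 + z))" by (rule norm_triangle_ineq4)
    also have "\<dots> < d" using x x' by (simp add: dist_norm)
    finally have "norm (z - T (x - x')) < d" .
    moreover have "norm (x - x') \<le> 2 * real n"
      using norm_triangle_ineq4[of x x'] x x' by simp
    ultimately show ?thesis by blast
  qed
  show thesis
  proof
    \<comment> \<open>The summand 1 keeps the constant positive when \<open>n = 0\<close>.\<close>
    show "4 * (real n + 1) / e > 0" using e by simp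
    fix z assume z: "z \<in> range T"
    show "\<exists>x. norm x \<le> 4 * (real n + 1) / e * norm z \<and> norm (z - T x) \<le> norm z / 2"
    proof (cases "z = 0")
      case True
      then show ?thesis by (intro exI[of _ 0]) (auto simp: T.zero)
    next
      case False
      \<comment> \<open>Scaling by \<open>s\<close> brings \<open>z\<close> to norm
        \<open>e / 2\<close>; an error of \<open>e / 4\<close> is then half the norm, a ratio that
        survives scaling back.\<close>
      define s where "s = e / (2 * norm z)"
      have s: "s > 0" using e False by (simp add: s_def)
      have "s *\<^sub>R z \<in> range T" using z by (auto simp flip: T.scaleR)
      moreover have "norm (s *\<^sub>R z) < e" using s e False by (simp add: s_def)
      ultimately obtain x where x: "norm x \<le> 2 * real n" "norm (s *\<^sub>R z - T x) < e / 4"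
        using approx[of "s *\<^sub>R z" "e / 4"] e by auto
      have "norm (z - T (inverse s *\<^sub>R x)) = norm (inverse s *\<^sub>R (s *\<^sub>R z - T x))"
        using s by (simp add: T.scaleR scaleR_diff_right)
      also have "\<dots> = inverse s * norm (s *\<^sub>R z - T x)" using s by simp
      also have "\<dots> \<le> inverse s * (e / 4)" using s x by (intro mult_left_mono) auto
      also have "\<dots> = norm z / 2" using e False by (simp add: s_def field_simps)
      finally have "norm (z - T (inverse s *\<^sub>R x)) \<le> norm z / 2" .
      moreover have "norm (inverse s *\<^sub>R x) \<le> inverse s * (2 * (real n + 1))"
        using s x by auto
      moreover have "inverse s * (2 * (real n + 1)) = 4 * (real n + 1) / e * norm z"
        using e False by (simp add: s_def field_simps)
      ultimately show ?thesis by metis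
    qed
  qed
qed

text \<open>Successive approximation: each correction at least halves the residual, so the
  corrections are dominated by a geometric series and sum to an exact preimage of \<open>T u\<close>
  of norm at most \<open>2 * C * norm (T u)\<close>. Injectivity identifies this preimage with
  \<open>u\<close>.\<close>

lemma bounded_below_of_closed_range:
  fixes T :: "'a::banach \<Rightarrow> 'b::{real_normed_vector,complete_space}"
  assumes T: "bounded_linear T" and inj: "\<And>x. T x = 0 \<Longrightarrow> x = 0" and cl: "closed (range T)"
  obtains c where "c > 0" and "\<And>x. c * norm x \<le> norm (T x)"
proof -
  interpret T: bounded_linear T by fact
  obtain C where C: "C > 0"
    and "\<And>z. z \<in> range T \<Longrightarrow> \<exists>x. norm x \<le> C * norm z \<and> norm (z - T x) \<le> norm z / 2"
    using approximate_preimage_of_closed_range[OF T cl] by blast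
  then obtain g where g: "\<And>z. z \<in> range T \<Longrightarrow> norm (g z) \<le> C * norm z"
    "\<And>z. z \<in> range T \<Longrightarrow> norm (z - T (g z)) \<le> norm z / 2"
    by metis
  have "norm u \<le> 2 * C * norm (T u)" for u
  proof -
    \<comment> \<open>\<open>z k\<close> is the residual after \<open>k\<close> corrections, and
      \<open>g (z k)\<close> is the next correction.\<close>
    define z where "z k = ((\<lambda>z. z - T (g z)) ^^ k) (T u)" for k
    have z0: "z 0 = T u" and zS: "z (Suc k) = z k - T (g (z k))" for k
      by (simp_all add: z_def)
    have zR: "z k \<in> range T" for k
      by (induction k) (auto simp: z0 zS simp flip: T.diff)
    have zn: "norm (z k) \<le> norm (T u) * (1/2) ^ k" for k
    proof (induction k)
      case (Suc k)
      then show ?case using g(2)[OF zR[of k]] by (simp add: zS)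
    qed (simp add: z0)
    have gn: "norm (g (z k)) \<le> C * norm (T u) * (1/2) ^ k" for k
    proof -
      have "norm (g (z k)) \<le> C * norm (z k)" by (rule g(1)[OF zR])
      also have "\<dots> \<le> C * (norm (T u) * (1/2) ^ k)" using zn C by (intro mult_left_mono) auto
      finally show ?thesis by (simp add: mult.assoc)
    qed
    have sums: "(\<lambda>k. C * norm (T u) * (1/2) ^ k) sums (C * norm (T u) * 2)"
      using sums_mult[OF geometric_sums[of "1/2::real"], of "C * norm (T u)"] by simp
    have sm: "summable (\<lambda>k. norm (g (z k)))"
      by (rule summable_comparison_test[OF _ sums_summable[OF sums]]) (use gn in auto)
    have "norm (\<Sum>k. g (z k)) \<le> (\<Sum>k. norm (g (z k)))" by (rule summable_norm[OF sm])
    also have "\<dots> \<le> (\<Sum>k. C * norm (T u) * (1/2) ^ k)"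
      by (rule suminf_le[OF gn sm sums_summable[OF sums]])
    also have "\<dots> = 2 * C * norm (T u)" using sums_unique[OF sums] by simp
    finally have bound: "norm (\<Sum>k. g (z k)) \<le> 2 * C * norm (T u)" .
    have "(\<lambda>k. T (g (z k))) sums T (\<Sum>k. g (z k))"
      by (rule T.sums[OF summable_sums[OF summable_norm_cancel[OF sm]]])
    moreover have "(\<lambda>k. T (g (z k))) sums T u"
    proof -
      have part: "(\<Sum>i<k. T (g (z i))) = T u - z k" for k
        by (induction k) (auto simp: z0 zS)
      have "(\<lambda>k. norm (T u) * (1/2) ^ k) \<longlonglongrightarrow> 0"
        by (intro tendsto_mult_right_zero LIMSEQ_power_zero) simp
      then have "z \<longlonglongrightarrow> 0"
        by (rule Lim_null_comparison[rotated]) (use zn in auto)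
      then have "(\<lambda>k. T u - z k) \<longlonglongrightarrow> T u - 0" by (intro tendsto_intros)
      then show ?thesis by (simp add: sums_def part)
    qed
    ultimately have "T (\<Sum>k. g (z k)) = T u" by (rule sums_unique2)
    then have "T ((\<Sum>k. g (z k)) - u) = 0" by (simp add: T.diff)
    then have "(\<Sum>k. g (z k)) = u" using inj by fastforce
    then show ?thesis using bound by simp
  qed
  with C show thesis
    by (intro that[of "1 / (2 * C)"]) (auto simp: field_simps)
qed

section \<open>Orthogonal decomposition along a closed subspace\<close>

text \<open>The point \<open>k\<close> is the point of \<open>K\<close> nearest to \<open>x\<close>:
  a minimising sequence is Cauchy by the parallelogram law, and minimality of the distance forces
  orthogonality.\<close>

lemma orthogonal_projection_onto_closed_subspace:
  fixes K :: "'a::{real_inner,complete_space} set"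
  assumes cl: "closed K" and K: "subspace K"
  obtains k where "k \<in> K" and "\<And>y. y \<in> K \<Longrightarrow> inner (x - k) y = 0"
proof -
  have ne: "K \<noteq> {}" using subspace_0[OF K] by auto
  define d where "d = infdist x K"
  have d_le: "d \<le> norm (x - y)" if "y \<in> K" for y
    using infdist_le[OF that, of x] by (simp add: d_def dist_norm)
  have d0: "d \<ge> 0" by (simp add: d_def infdist_nonneg)
  have "\<exists>y\<in>K. norm (x - y) < d + 1 / real (Suc n)" for n
    using cInf_lessD[of "(\<lambda>y. dist x y) ` K" "d + 1 / real (Suc n)"] ne
    by (auto simp: d_def infdist_def dist_norm)
  then obtain k where kK: "\<And>n. k n \<in> K" and kd: "\<And>n. norm (x - k n) < d + 1 / real (Suc n)"
    by metis
  \<comment> \<open>The parallelogram law for \<open>x - a\<close> and \<open>x - b\<close>; the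
    midpoint of \<open>a\<close> and \<open>b\<close> lies in \<open>K\<close>, hence at distance at
    least \<open>d\<close> from \<open>x\<close>.\<close>
  have par: "(norm (a - b))\<^sup>2 \<le> 2 * (norm (x - a))\<^sup>2 + 2 * (norm (x - b))\<^sup>2 - 4 * d\<^sup>2"
    if "a \<in> K" "b \<in> K" for a b
  proof -
    have "(1/2) *\<^sub>R (a + b) \<in> K" using that K by (intro subspace_scale subspace_add)
    then have "d\<^sup>2 \<le> (norm (x - (1/2) *\<^sub>R (a + b)))\<^sup>2"
      using d_le d0 by (intro power_mono)
    also have "\<dots> = (2 * (norm (x - a))\<^sup>2 + 2 * (norm (x - b))\<^sup>2 - (norm (a - b))\<^sup>2) / 4"
      by (simp add: power2_norm_eq_inner inner_simps inner_commute field_simps)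
    finally show ?thesis by simp
  qed
  have lim: "(\<lambda>n. norm (x - k n)) \<longlonglongrightarrow> d"
  proof (rule tendsto_sandwich)
    show "\<forall>\<^sub>F n in sequentially. d \<le> norm (x - k n)" using d_le kK by simp
    show "\<forall>\<^sub>F n in sequentially. norm (x - k n) \<le> d + 1 / real (Suc n)"
      using kd by (intro always_eventually) (simp add: less_imp_le)
    show "(\<lambda>n. d + 1 / real (Suc n)) \<longlonglongrightarrow> d"
      using tendsto_add[OF tendsto_const[of d] LIMSEQ_inverse_real_of_nat]
      by (simp add: inverse_eq_divide)
  qed simp
  have "Cauchy k"
  proof (rule metric_CauchyI)
    fix e :: real assume e: "e > 0"
    have "(\<lambda>n. (norm (x - k n))\<^sup>2) \<longlonglongrightarrow> d\<^sup>2" by (intro tendsto_intros lim)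
    then have "\<forall>\<^sub>F n in sequentially. (norm (x - k n))\<^sup>2 < d\<^sup>2 + e\<^sup>2 / 4"
      by (rule order_tendstoD) (use e in simp)
    then obtain N where N: "\<And>n. n \<ge> N \<Longrightarrow> (norm (x - k n))\<^sup>2 < d\<^sup>2 + e\<^sup>2 / 4"
      by (auto simp: eventually_sequentially)
    have "dist (k m) (k n) < e" if "m \<ge> N" "n \<ge> N" for m n
    proof -
      have "(norm (k m - k n))\<^sup>2 < e\<^sup>2"
        using par[OF kK kK, of m n] N[OF that(1)] N[OF that(2)] by simp
      then show ?thesis using e by (simp add: dist_norm power_less_imp_less_base)
    qed
    then show "\<exists>N. \<forall>m\<ge>N. \<forall>n\<ge>N. dist (k m) (k n) < e" by blast
  qed
  then obtain l where l: "k \<longlonglongrightarrow> l" using Cauchy_convergent convergent_def by blast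
  have lK: "l \<in> K" using closed_sequentially[OF cl _ l] kK by blast
  have "(\<lambda>n. norm (x - k n)) \<longlonglongrightarrow> norm (x - l)" by (intro tendsto_intros l)
  then have ld: "norm (x - l) = d" using lim LIMSEQ_unique by blast
  show thesis
  proof (rule that[of l])
    show "l \<in> K" by (rule lK)
    fix y assume y: "y \<in> K"
    show "inner (x - l) y = 0"
    proof (cases "y = 0")
      case False
      \<comment> \<open>This \<open>t\<close> minimises the distance from \<open>x\<close> along the
        line through \<open>l\<close> in direction \<open>y\<close>; the decrease it would bring
        must vanish.\<close>
      define t where "t = inner (x - l) y / inner y y"
      have "l + t *\<^sub>R y \<in> K" using lK y K by (intro subspace_add subspace_scale)
      then have "(norm (x - l))\<^sup>2 \<le> (norm (x - (l + t *\<^sub>R y)))\<^sup>2"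
        using d_le ld by (intro power_mono) auto
      also have "\<dots> = (norm (x - l))\<^sup>2 - (2 * t * inner (x - l) y - t\<^sup>2 * inner y y)"
        unfolding power2_norm_eq_inner
        by (simp add: inner_simps inner_commute algebra_simps power2_eq_square)
      also have "2 * t * inner (x - l) y - t\<^sup>2 * inner y y = (inner (x - l) y)\<^sup>2 / inner y y"
        using False by (simp add: t_def field_simps power2_eq_square)
      finally have "(inner (x - l) y)\<^sup>2 / inner y y \<le> 0" by simp
      then show ?thesis using False
        by (metis divide_le_0_iff inner_gt_zero_iff not_less power2_eq_iff_nonneg power_zero_numeral
            zero_le_power2 zero_less_power2)
    qed simp
  qed
qed

lemma norm_scaleC: "norm (c *\<^sub>C x) = cmod c * norm (x::'a::complex_inner)"
proof -
  have "complex_of_real ((norm (c *\<^sub>C x))\<^sup>2) = c * cinner x (c *\<^sub>C x)"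
    by (simp only: cinner_self[symmetric] cinner_scaleC_left)
  also have "cinner x (c *\<^sub>C x) = cnj c * cinner x x"
    by (metis cinner_commute cinner_scaleC_left complex_cnj_mult)
  also have "c * (cnj c * cinner x x) = complex_of_real ((cmod c * norm x)\<^sup>2)"
    unfolding cinner_self mult.assoc[symmetric] complex_norm_square[symmetric]
    by (simp add: power_mult_distrib)
  finally have "(norm (c *\<^sub>C x))\<^sup>2 = (cmod c * norm x)\<^sup>2"
    using of_real_eq_iff by blast
  then show ?thesis by (simp add: power2_eq_iff_nonneg)
qed

lemma scaleC_scaleR_commute: "c *\<^sub>C (r *\<^sub>R x) = r *\<^sub>R (c *\<^sub>C (x::'a::complex_inner))"
  by (metis scaleC_of_real scaleC_scaleC mult.commute)

lemma bounded_linear_scaleC: "bounded_linear (\<lambda>x::'a::complex_inner. c *\<^sub>C x)"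
  by (rule bounded_linear_intro[of _ "cmod c"])
    (auto simp: scaleC_add_right scaleC_scaleR_commute norm_scaleC)

lemma tendsto_scaleC_left:
  assumes "(c \<longlongrightarrow> l) F"
  shows "((\<lambda>n. c n *\<^sub>C (x::'a::complex_inner)) \<longlongrightarrow> l *\<^sub>C x) F"
proof -
  have "((\<lambda>n. cmod (c n - l) * norm x) \<longlongrightarrow> 0) F"
    using assms by (intro tendsto_mult_left_zero tendsto_norm_zero) (simp add: LIM_zero)
  moreover have "norm (c n *\<^sub>C x - l *\<^sub>C x) = cmod (c n - l) * norm x" for n
    by (metis complex_vector.scale_left_diff_distrib norm_scaleC)
  ultimately have "((\<lambda>n. norm (c n *\<^sub>C x - l *\<^sub>C x)) \<longlongrightarrow> 0) F" by simp
  then show ?thesis by (rule LIM_zero_cancel[OF tendsto_norm_zero_cancel])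
qed

lemma closure_complex_subspace:
  fixes N :: "'a::complex_inner set"
  assumes N: "complex_vector.subspace N"
  shows "complex_vector.subspace (closure N)"
proof -
  have add: "x + y \<in> closure N" if xy: "x \<in> closure N" "y \<in> closure N" for x y
  proof -
    obtain p q where pq: "\<And>n. p n \<in> N" "p \<longlonglongrightarrow> x" "\<And>n. q n \<in> N" "q \<longlonglongrightarrow> y"
      using xy unfolding closure_sequential by metis
    show ?thesis unfolding closure_sequential
      by (intro exI[of _ "\<lambda>n. p n + q n"] conjI allI complex_vector.subspace_add[OF N]
          tendsto_add pq)
  qed
  have scale: "c *\<^sub>C y \<in> closure N" if "y \<in> closure N" for c y
  proof -
    have "c *\<^sub>C y \<in> (\<lambda>x. c *\<^sub>C x) ` closure N" using that by (rule imageI)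
    also have "\<dots> \<subseteq> closure ((\<lambda>x. c *\<^sub>C x) ` N)"
      by (rule closure_bounded_linear_image_subset[OF bounded_linear_scaleC])
    also have "\<dots> \<subseteq> closure N"
      by (rule closure_mono) (use complex_vector.subspace_scale[OF N] in auto)
    finally show ?thesis .
  qed
  have "0 \<in> closure N" using complex_vector.subspace_0[OF N] by (rule subsetD[OF closure_subset])
  with add scale show ?thesis by (intro complex_vector.subspaceI)
qed

text \<open>The nearest point in \<open>K\<close> gives orthogonality only for the real inner
  product. Since \<open>K\<close> is a complex subspace, testing against
  \<open>\<i> *\<^sub>C y\<close> as well also kills the imaginary part of the Hermitian
  form.\<close>

lemma ominus_decomposition:
  fixes M K :: "'a::complex_hilbert set"
  assumes M: "complex_vector.subspace M" and K: "complex_vector.subspace K"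
    and cl: "closed K" and KM: "K \<subseteq> M" and x: "x \<in> M"
  obtains k g where "k \<in> K" and "g \<in> M \<ominus> K" and "x = k + g"
proof -
  have sub: "subspace K"
  proof (rule subspaceI)
    show "c *\<^sub>R x \<in> K" if "x \<in> K" for c x
      using complex_vector.subspace_scale[OF K that, of "complex_of_real c"]
      by (simp add: scaleC_of_real)
  qed (use K in \<open>auto simp: complex_vector.subspace_def\<close>)
  obtain k where k: "k \<in> K" and orth: "\<And>y. y \<in> K \<Longrightarrow> inner (x - k) y = 0"
    using orthogonal_projection_onto_closed_subspace[OF cl sub] by blast
  have "cinner (x - k) y = 0" if y: "y \<in> K" for y
  proof (rule complex_eqI)
    show "Re (cinner (x - k) y) = Re 0" using orth[OF y] by (simp add: Re_cinner)
    have "cinner (x - k) (\<i> *\<^sub>C y) = cnj (\<i> * cinner y (x - k))"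
      by (subst cinner_commute) (simp add: cinner_scaleC_left)
    also have "\<dots> = - \<i> * cinner (x - k) y"
      by (subst (2) cinner_commute) simp
    finally have "Im (cinner (x - k) y) = Re (cinner (x - k) (\<i> *\<^sub>C y))" by simp
    then show "Im (cinner (x - k) y) = Im 0"
      using orth[OF complex_vector.subspace_scale[OF K y]] by (simp add: Re_cinner)
  qed
  moreover have "x - k \<in> M"
    using complex_vector.subspace_diff[OF M x] k KM by blast
  ultimately have "x - k \<in> M \<ominus> K" by (simp add: ominus_def)
  with k show thesis by (intro that[of k "x - k"]) auto
qed

section \<open>Dimension counting and choice of subsequences\<close>

text \<open>The vectors are taken from a basis of \<open>M\<close>. A finite basis has exactly
  \<open>hdim M\<close> elements, and an infinite one has subsets of every finite size.\<close>

lemma le_hdim_obtain_independent: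
  assumes "enat k \<le> hdim (M :: 'a::complex_inner set)"
  obtains B where "finite B" "B \<subseteq> M" "complex_vector.independent B" "card B = k"
proof -
  obtain B where B: "B \<subseteq> M" "complex_vector.independent B" "M \<subseteq> cspan B" "card B = cdim M"
    using complex_vector.basis_exists[of M] by blast
  have "\<exists>A\<subseteq>B. finite A \<and> card A = k"
  proof (cases "finite B")
    case True
    then have "hdim M = enat (card B)" using B by (auto simp: hdim_def)
    with assms have "k \<le> card B" by simp
    then show ?thesis using obtain_subset_with_card_n[of k B] True by metis
  next
    case False
    then show ?thesis using infinite_arbitrarily_large[of B k] by blast
  qed
  then obtain A where "A \<subseteq> B" "finite A" "card A = k" by blast
  with B show thesis
    using that[of A] complex_vector.independent_mono by (metis subset_trans)
qed

lemma nontrivial_relation_if_hdim_less: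
  assumes B: "finite B" and g: "\<And>b. b \<in> B \<Longrightarrow> g b \<in> (G :: 'a::complex_inner set)"
    and less: "hdim G < enat (card B)"
  obtains c where "\<exists>b\<in>B. c b \<noteq> 0" and "(\<Sum>b\<in>B. c b *\<^sub>C g b) = 0"
\<comment> \<open>The relation is indexed by \<open>B\<close>, not by the image of \<open>g\<close>:
  if \<open>g\<close> repeats a value, the image may be independent, and the coefficients 1 and -1
  at the two indices give the relation instead.\<close>
proof (cases "inj_on g B")
  case True
  obtain A where A: "finite A" "G \<subseteq> cspan A"
    using less by (auto simp: hdim_def split: if_splits)
  then have dim: "cdim G < card B" using less by (auto simp: hdim_def split: if_splits)
  have "complex_vector.dependent (g ` B)"
  proof (rule ccontr)
    assume ind: "\<not> complex_vector.dependent (g ` B)"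
    obtain A' where A': "A' \<subseteq> G" "complex_vector.independent A'" "G \<subseteq> cspan A'" "card A' = cdim G"
      by (rule complex_vector.basis_exists)
    have "finite A'"
      using complex_vector.independent_span_bound[OF A(1) A'(2)] A'(1) A(2) by (meson subset_trans)
    then have "card (g ` B) \<le> card A'"
      using complex_vector.independent_span_bound[OF _ ind, of A'] g A'(3)
      by (meson image_subsetI subset_trans)
    then show False using dim A'(4) card_image[OF True] by simp
  qed
  then obtain u where u: "\<exists>v\<in>g ` B. u v \<noteq> 0" "(\<Sum>v\<in>g ` B. u v *\<^sub>C v) = 0"
    using complex_vector.dependent_finite[of "g ` B"] B by auto
  show thesis
    by (rule that[of "u \<circ> g"]) (use u in \<open>auto simp: sum.reindex[OF True]\<close>)
next
  case False
  then obtain a b where ab: "a \<in> B" "b \<in> B" "a \<noteq> b" "g a = g b" by (auto simp: inj_on_def)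
  define c :: "'b \<Rightarrow> complex" where "c x = (if x = a then 1 else if x = b then -1 else 0)" for x
  have "(\<Sum>x\<in>B. c x *\<^sub>C g x) = (\<Sum>x\<in>{a, b}. c x *\<^sub>C g x)"
    by (rule sum.mono_neutral_right) (use ab B in \<open>auto simp: c_def\<close>)
  also have "\<dots> = 0" using ab by (simp add: c_def)
  finally have "(\<Sum>x\<in>B. c x *\<^sub>C g x) = 0" .
  then show thesis using ab by (intro that[of c]) (auto simp: c_def)
qed

text \<open>Bolzano-Weierstrass for finitely many coordinates at once; convergence uniform over
  \<open>B\<close> is specialised to each coordinate.\<close>

lemma bounded_coefficients_subsequence:
  fixes c :: "nat \<Rightarrow> 'b \<Rightarrow> 'c::heine_borel"
  assumes "finite B" and "\<And>b. b \<in> B \<Longrightarrow> bounded (range (\<lambda>n. c n b))"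
  obtains r l where "strict_mono r" and "\<And>b. b \<in> B \<Longrightarrow> (\<lambda>n. c (r n :: nat) b) \<longlonglongrightarrow> l b"
proof -
  have "\<forall>\<delta>\<subseteq>B. \<exists>l::'b \<Rightarrow> 'c. \<exists>r::nat\<Rightarrow>nat. strict_mono r \<and>
      (\<forall>\<epsilon>>0. \<forall>\<^sub>F n in sequentially. \<forall>i\<in>\<delta>. dist (c (r n) i) (l i) < \<epsilon>)"
    by (rule compact_lemma_general[where unproj = "\<lambda>x. x" and proj = "\<lambda>x b. x b"])
      (use assms in \<open>auto simp: image_image\<close>)
  then obtain l r where "strict_mono r"
    "\<forall>\<epsilon>>0. \<forall>\<^sub>F n in sequentially. \<forall>i\<in>B. dist (c (r n) i) (l i) < \<epsilon>"
    by blast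
  then show thesis
    by (intro that[of r l] tendstoI) (blast intro: eventually_mono)+
qed

section \<open>Limits of vectors in the approximating subspaces\<close>

text \<open>The lower bound for \<open>T\<close> first bounds the \<open>u n\<close> eventually, so
  that \<open>T (u n)\<close> has the same limit as \<open>S n (u n)\<close>, and then makes
  \<open>u\<close> Cauchy; its limit is the preimage \<open>g\<close>.\<close>

lemma limit_of_images_of_approximating_subspaces:
  fixes T P :: "'a::{real_normed_vector,complete_space} \<Rightarrow> 'a"
    and S Q :: "nat \<Rightarrow> 'a \<Rightarrow> 'a"
  assumes T: "bounded_linear T" and S: "\<And>n. bounded_linear (S n)"
    and c: "c > 0" "\<And>x. c * norm x \<le> norm (T x)"
    and ST: "(\<lambda>n. onorm (\<lambda>x. S n x - T x)) \<longlonglongrightarrow> 0"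
    and Q: "\<And>n. linear (Q n)" "\<And>n x. norm (Q n x) \<le> norm x"
    and QP: "\<And>x. (\<lambda>n. Q n x) \<longlonglongrightarrow> P x"
    and u: "\<And>n. Q n (u n) = u n" and f: "(\<lambda>n. S n (u n)) \<longlonglongrightarrow> f"
  obtains g where "P g = g" and "T g = f"
proof -
  interpret T: bounded_linear T by fact
  define \<epsilon> where "\<epsilon> n = onorm (\<lambda>x. S n x - T x)" for n
  have \<epsilon>: "norm (S n x - T x) \<le> \<epsilon> n * norm x" for n x
    unfolding \<epsilon>_def by (rule onorm[OF bounded_linear_sub[OF S T]])
  have \<epsilon>0: "\<epsilon> \<longlonglongrightarrow> 0" using ST unfolding \<epsilon>_def .
  obtain b where b: "\<And>n. norm (S n (u n)) \<le> b"
    using convergent_imp_Bseq[of "\<lambda>n. S n (u n)"] f by (auto simp: convergent_def Bseq_def)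
  \<comment> \<open>With an operator error below \<open>c / 2\<close>, half of the lower bound is
    left for \<open>S n\<close>; this produces the bound \<open>2 * b / c\<close>.\<close>
  have "\<forall>\<^sub>F n in sequentially. \<epsilon> n < c / 2"
    using order_tendstoD(2)[OF \<epsilon>0, of "c / 2"] c(1) by simp
  then have ev: "\<forall>\<^sub>F n in sequentially. norm (u n) \<le> 2 * b / c"
  proof (rule eventually_mono)
    fix n assume n: "\<epsilon> n < c / 2"
    have "c * norm (u n) \<le> norm (T (u n))" by (rule c)
    also have "\<dots> \<le> norm (S n (u n)) + norm (S n (u n) - T (u n))"
      by (metis norm_minus_commute norm_triangle_sub)
    also have "\<dots> \<le> b + c / 2 * norm (u n)"
      using b[of n] order_trans[OF \<epsilon> mult_right_mono[OF less_imp_le[OF n] norm_ge_zero]]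
      by (intro add_mono)
    finally show "norm (u n) \<le> 2 * b / c" using c(1) by (simp add: field_simps)
  qed
  have \<epsilon>_nonneg: "\<epsilon> n \<ge> 0" for n
    unfolding \<epsilon>_def by (rule onorm_pos_le[OF bounded_linear_sub[OF S T]])
  have "(\<lambda>n. S n (u n) - T (u n)) \<longlonglongrightarrow> 0"
  proof (rule Lim_null_comparison)
    show "(\<lambda>n. \<epsilon> n * (2 * b / c)) \<longlonglongrightarrow> 0" by (rule tendsto_mult_left_zero[OF \<epsilon>0])
    show "\<forall>\<^sub>F n in sequentially. norm (S n (u n) - T (u n)) \<le> \<epsilon> n * (2 * b / c)"
      using ev
      by (rule eventually_mono) (rule order_trans[OF \<epsilon> mult_left_mono[OF _ \<epsilon>_nonneg]])
  qed
  from tendsto_diff[OF f this] have Tu: "(\<lambda>n. T (u n)) \<longlonglongrightarrow> f" by simp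
  have "Cauchy u"
  proof (rule metric_CauchyI)
    fix e :: real assume e: "e > 0"
    obtain N where N: "\<And>m n. m \<ge> N \<Longrightarrow> n \<ge> N \<Longrightarrow> dist (T (u m)) (T (u n)) < c * e"
      using metric_CauchyD[OF LIMSEQ_imp_Cauchy[OF Tu], of "c * e"] e c(1) by auto
    have "dist (u m) (u n) < e" if "m \<ge> N" "n \<ge> N" for m n
    proof -
      have "c * dist (u m) (u n) < c * e"
        using c(2)[of "u m - u n"] N[OF that] by (simp add: dist_norm T.diff)
      then show ?thesis using c(1) by simp
    qed
    then show "\<exists>N. \<forall>m\<ge>N. \<forall>n\<ge>N. dist (u m) (u n) < e" by blast
  qed
  then obtain g where g: "u \<longlonglongrightarrow> g" using Cauchy_convergent convergent_def by blast
  have "T g = f" using LIMSEQ_unique[OF T.tendsto[OF g] Tu] .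
  \<comment> \<open>Strong convergence concerns a fixed argument. The uniform contraction bound on
    \<open>Q n\<close> replaces the moving argument \<open>u n\<close> by \<open>g\<close>.\<close>
  moreover have "(\<lambda>n. Q n (u n - g)) \<longlonglongrightarrow> 0"
    by (rule Lim_null_comparison[OF _ tendsto_norm_zero[OF LIM_zero[OF g]]]) (use Q in auto)
  then have "(\<lambda>n. u n - Q n g) \<longlonglongrightarrow> 0" by (simp add: linear_diff[OF Q(1)] u)
  then have "(\<lambda>n. u n - (u n - Q n g)) \<longlonglongrightarrow> g - 0" by (rule tendsto_diff[OF g])
  then have "P g = g" using LIMSEQ_unique[OF QP[of g]] by simp
  ultimately show thesis using that by blast
qed

section \<open>Orthogonal projections and images of complex subspaces\<close>

lemma orthogonal_projection_norm_le:
  assumes "orthogonal_projection P"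
  shows "norm (P x) \<le> norm x"
proof -
  have "cinner (P x) (P x) = cinner x (P x)"
    using assms by (simp add: orthogonal_projection_def)
  then have "(norm (P x))\<^sup>2 = inner x (P x)"
    by (simp add: power2_norm_eq_inner flip: Re_cinner)
  also have "\<dots> \<le> norm x * norm (P x)" by (rule norm_cauchy_schwarz)
  finally show ?thesis by (cases "P x = 0") (auto simp: power2_eq_square)
qed

lemma orthogonal_projection_range_iff:
  assumes "orthogonal_projection P"
  shows "y \<in> range P \<longleftrightarrow> P y = y"
  using assms unfolding orthogonal_projection_def by (metis rangeE rangeI)

lemma closed_range_orthogonal_projection:
  assumes P: "orthogonal_projection P"
  shows "closed (range P)"
proof -
  have "bounded_linear P" using P by (simp add: orthogonal_projection_def bounded_clinear_def)
  then have "continuous_on UNIV P" by (rule linear_continuous_on)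
  then have "closed {x. P x = x}" by (intro closed_Collect_eq continuous_on_id)
  moreover have "range P = {x. P x = x}" using orthogonal_projection_range_iff[OF P] by blast
  ultimately show ?thesis by simp
qed

lemma bounded_clinear_sum:
  assumes "bounded_clinear T"
  shows "T (\<Sum>b\<in>B. c b *\<^sub>C v b) = (\<Sum>b\<in>B. c b *\<^sub>C T (v b))"
  using assms
  by (simp add: bounded_clinear_def linear_sum[OF bounded_linear.linear])

lemma bounded_clinear_image_subspace:
  assumes T: "bounded_clinear T" and M: "complex_vector.subspace M"
  shows "complex_vector.subspace (T ` M)"
proof (rule complex_vector.subspaceI)
  interpret T: bounded_linear T using T by (simp add: bounded_clinear_def)
  show "0 \<in> T ` M" using complex_vector.subspace_0[OF M] T.zero by force
  show "x + y \<in> T ` M" if "x \<in> T ` M" "y \<in> T ` M" for x y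
    using that complex_vector.subspace_add[OF M] by (auto simp flip: T.add)
  show "c *\<^sub>C x \<in> T ` M" if "x \<in> T ` M" for c x
    using that complex_vector.subspace_scale[OF M] T
    by (auto simp: bounded_clinear_def) (metis imageI)
qed

section \<open>Semicontinuity of the index\<close>

text \<open>Each \<open>Q b\<close> splits into a part in the closure of the image and a part in its
  complement, whose dimension is \<open>ind S Q\<close>. A nontrivial relation between the latter
  parts leaves a combination in the closure. Normalising the coefficients keeps them from all
  tending to 0 in a later limit.\<close>

lemma normalized_combination_if_ind_less:
  fixes S Q :: "'a::complex_hilbert \<Rightarrow> 'a"
  assumes S: "bounded_clinear S" and Q: "Q \<in> Lat S" and B: "finite B"
    and less: "ind S Q < enat (card B)"
  obtains c where "(\<Sum>b\<in>B. cmod (c b)) = 1"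
    and "Q (\<Sum>b\<in>B. c b *\<^sub>C b) \<in> closure (S ` range Q)"
proof -
  have Qp: "orthogonal_projection Q" and inv: "S ` range Q \<subseteq> range Q"
    using Q by (auto simp: Lat_iff_invariant_range)
  have Ql: "bounded_clinear Q" using Qp by (simp add: orthogonal_projection_def)
  have sR: "complex_vector.subspace (range Q)"
    by (rule bounded_clinear_image_subspace[OF Ql complex_vector.subspace_UNIV])
  have sN: "complex_vector.subspace (S ` range Q)"
    by (rule bounded_clinear_image_subspace[OF S sR])
  let ?K = "closure (S ` range Q)"
  \<comment> \<open>Invariance and closedness of the range place the closure inside it, so the
    decomposition can take place within \<open>range Q\<close>.\<close>
  have KR: "?K \<subseteq> range Q"
    using closure_minimal[OF inv closed_range_orthogonal_projection[OF Qp]] .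
  have sK: "complex_vector.subspace ?K" by (rule closure_complex_subspace[OF sN])
  have "\<exists>k g. k \<in> ?K \<and> g \<in> range Q \<ominus> ?K \<and> Q b = k + g" for b
    using ominus_decomposition[OF sR sK closed_closure KR, of "Q b"] by blast
  then obtain k g where k: "\<And>b. k b \<in> ?K" and g: "\<And>b. g b \<in> range Q \<ominus> ?K"
    and Qb: "\<And>b. Q b = k b + g b" by metis
  obtain c where c: "\<exists>b\<in>B. c b \<noteq> 0" "(\<Sum>b\<in>B. c b *\<^sub>C g b) = 0"
    using nontrivial_relation_if_hdim_less[OF B, of g "range Q \<ominus> ?K"] g less
    unfolding ind_def by blast
  define s where "s = (\<Sum>b\<in>B. cmod (c b))"
  have s: "s > 0" unfolding s_def using c(1) B by (auto intro: sum_pos2)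
  define d where "d b = inverse (complex_of_real s) * c b" for b
  show thesis
  proof
    show "(\<Sum>b\<in>B. cmod (d b)) = 1"
      using s by (simp add: d_def norm_mult norm_inverse flip: sum_distrib_left s_def)
    have "(\<Sum>b\<in>B. d b *\<^sub>C g b) = inverse (complex_of_real s) *\<^sub>C (\<Sum>b\<in>B. c b *\<^sub>C g b)"
      by (simp add: d_def complex_vector.scale_sum_right)
    then have "(\<Sum>b\<in>B. d b *\<^sub>C g b) = 0" by (simp add: c(2))
    moreover have "Q (\<Sum>b\<in>B. d b *\<^sub>C b) = (\<Sum>b\<in>B. d b *\<^sub>C Q b)"
      by (rule bounded_clinear_sum[OF Ql])
    moreover have "(\<Sum>b\<in>B. d b *\<^sub>C Q b) = (\<Sum>b\<in>B. d b *\<^sub>C k b) + (\<Sum>b\<in>B. d b *\<^sub>C g b)"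
      by (simp add: Qb scaleC_add_right sum.distrib)
    ultimately have "Q (\<Sum>b\<in>B. d b *\<^sub>C b) = (\<Sum>b\<in>B. d b *\<^sub>C k b)" by simp
    also have "\<dots> \<in> ?K"
      by (intro complex_vector.subspace_sum[OF sK] complex_vector.subspace_scale[OF sK] k)
    finally show "Q (\<Sum>b\<in>B. d b *\<^sub>C b) \<in> ?K" .
  qed
qed

text \<open>A fixed finite bound valid for every \<open>n\<close> passes to the limit;
  semicontinuity then follows by contradiction along a subsequence.\<close>

lemma ind_less_of_limit:
  fixes T P :: "'a::complex_hilbert \<Rightarrow> 'a" and S Q :: "nat \<Rightarrow> 'a \<Rightarrow> 'a"
  assumes T: "bounded_clinear T" and S: "\<And>n. bounded_clinear (S n)"
    and P: "P \<in> Lat T" and Q: "\<And>n. Q n \<in> Lat (S n)"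
    and below: "bounded_from_below T"
    and ST: "(\<lambda>n. onorm (\<lambda>x. S n x - T x)) \<longlonglongrightarrow> 0"
    and QP: "\<And>x. (\<lambda>n. Q n x) \<longlonglongrightarrow> P x"
    and less: "\<And>n. ind (S n) (Q n) < enat k"
  shows "ind T P < enat k"
proof (rule ccontr)
  assume "\<not> ?thesis"
  then have "enat k \<le> hdim (range P \<ominus> closure (T ` range P))" by (simp add: ind_def)
  then obtain B where B: "finite B" "B \<subseteq> range P \<ominus> closure (T ` range P)"
    "complex_vector.independent B" "card B = k"
    by (rule le_hdim_obtain_independent)
  have "\<exists>c. (\<Sum>b\<in>B. cmod (c b)) = 1 \<and> Q n (\<Sum>b\<in>B. c b *\<^sub>C b) \<in> closure (S n ` range (Q n))" for n
    using normalized_combination_if_ind_less[OF S Q B(1)] less B(4) by metis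
  then obtain c where c1: "\<And>n. (\<Sum>b\<in>B. cmod (c n b)) = 1"
    and cK: "\<And>n. Q n (\<Sum>b\<in>B. c n b *\<^sub>C b) \<in> closure (S n ` range (Q n))" by metis
  have "bounded (range (\<lambda>n. c n b))" if "b \<in> B" for b
  proof -
    have "cmod (c n b) \<le> 1" for n
      using member_le_sum[OF that, of "\<lambda>b. cmod (c n b)"] B(1) c1[of n] by simp
    then show ?thesis by (auto simp: bounded_iff)
  qed
  then obtain r l where r: "strict_mono r" and l: "\<And>b. b \<in> B \<Longrightarrow> (\<lambda>n. c (r n) b) \<longlonglongrightarrow> l b"
    using bounded_coefficients_subsequence[OF B(1), of c] by blast
  define f where "f = (\<Sum>b\<in>B. l b *\<^sub>C b)"
  define v where "v n = (\<Sum>b\<in>B. c (r n) b *\<^sub>C b)" for n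
  have v: "v \<longlonglongrightarrow> f" unfolding v_def f_def by (intro tendsto_sum tendsto_scaleC_left l)
  have Pp: "orthogonal_projection P" using P by (simp add: Lat_def)
  have Qp: "orthogonal_projection (Q n)" for n using Q[of n] by (simp add: Lat_def)
  have Ql: "linear (Q n)" for n
    using Qp[of n] by (simp add: orthogonal_projection_def bounded_clinear_def bounded_linear.linear)
  have Sb: "bounded_linear (S n)" for n using S[of n] by (simp add: bounded_clinear_def)
  have Tb: "bounded_linear T" using T by (simp add: bounded_clinear_def)
  have QPr: "(\<lambda>n. Q (r n) x) \<longlonglongrightarrow> P x" for x
    using LIMSEQ_subseq_LIMSEQ[OF QP r] by (simp add: o_def)
  have sR: "complex_vector.subspace (range P)"
    using Pp by (intro bounded_clinear_image_subspace complex_vector.subspace_UNIV)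
      (simp add: orthogonal_projection_def)
  have BP: "b \<in> range P" if "b \<in> B" for b
    using B(2) that by (auto simp: ominus_def)
  have "f \<in> range P"
    unfolding f_def
    by (intro complex_vector.subspace_sum[OF sR] complex_vector.subspace_scale[OF sR] BP)
  then have Pf: "P f = f" by (simp add: orthogonal_projection_range_iff[OF Pp])
  have "(\<lambda>n. Q (r n) (v n - f)) \<longlonglongrightarrow> 0"
    by (rule Lim_null_comparison[OF _ tendsto_norm_zero[OF LIM_zero[OF v]]])
      (simp add: orthogonal_projection_norm_le[OF Qp])
  then have "(\<lambda>n. Q (r n) (v n) - Q (r n) f) \<longlonglongrightarrow> 0" by (simp add: linear_diff[OF Ql])
  from tendsto_add[OF this QPr[of f]] have Qv: "(\<lambda>n. Q (r n) (v n)) \<longlonglongrightarrow> f" by (simp add: Pf)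
  \<comment> \<open>Membership in the closure yields only approximate preimages; an error tending to
    0 is enough for the limit.\<close>
  have "\<exists>u. Q (r n) u = u \<and> dist (S (r n) u) (Q (r n) (v n)) < inverse (real (Suc n))" for n
  proof -
    have "inverse (real (Suc n)) > 0" by simp
    then obtain y where y: "y \<in> S (r n) ` range (Q (r n))" "dist y (Q (r n) (v n)) < inverse (real (Suc n))"
      using cK[of "r n"] unfolding closure_approachable v_def by blast
    then show ?thesis using orthogonal_projection_range_iff[OF Qp] by blast
  qed
  then obtain u where u: "\<And>n. Q (r n) (u n) = u n"
    and ud: "\<And>n. dist (S (r n) (u n)) (Q (r n) (v n)) < inverse (real (Suc n))" by metis
  have "(\<lambda>n. S (r n) (u n) - Q (r n) (v n)) \<longlonglongrightarrow> 0"
    by (rule Lim_null_comparison[OF _ LIMSEQ_inverse_real_of_nat])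
      (use ud in \<open>auto simp: dist_norm less_imp_le\<close>)
  from tendsto_add[OF this Qv] have Su: "(\<lambda>n. S (r n) (u n)) \<longlonglongrightarrow> f" by simp
  obtain \<gamma> where \<gamma>: "\<gamma> > 0" "\<And>x. \<gamma> * norm x \<le> norm (T x)"
    using bounded_below_of_closed_range[OF Tb] below by (auto simp: bounded_from_below_def)
  have STr: "(\<lambda>n. onorm (\<lambda>x. S (r n) x - T x)) \<longlonglongrightarrow> 0"
    using LIMSEQ_subseq_LIMSEQ[OF ST r] by (simp add: o_def)
  obtain g where g: "P g = g" "T g = f"
    using limit_of_images_of_approximating_subspaces
      [OF Tb Sb \<gamma> STr Ql orthogonal_projection_norm_le[OF Qp] QPr u Su] by blast
  have "f \<in> T ` range P" using g by (metis image_eqI rangeI)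
  then have fcl: "f \<in> closure (T ` range P)" by (rule subsetD[OF closure_subset])
  \<comment> \<open>\<open>B\<close> is orthogonal to the closure of the image of
    \<open>range P\<close>, which contains \<open>f\<close>; since \<open>f\<close> is itself a
    combination of \<open>B\<close>, it is orthogonal to itself.\<close>
  have "cinner b f = 0" if "b \<in> B" for b
    using B(2) that fcl by (auto simp: ominus_def)
  moreover have "cinner f f = (\<Sum>b\<in>B. l b * cinner b f)"
  proof -
    have "cinner (\<Sum>b\<in>A. l b *\<^sub>C b) f = (\<Sum>b\<in>A. l b * cinner b f)" if "finite A" for A
      using that
    proof (induction A)
      case empty
      show ?case using cinner_scaleC_left[of 0 0 f] by simp
    qed (simp add: cinner_add_left cinner_scaleC_left)
    then show ?thesis using B(1) by (simp add: f_def)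
  qed
  ultimately have "cinner f f = 0" by simp
  then have "f = 0" by (simp add: cinner_self)
  then have l0: "l b = 0" if "b \<in> B" for b
    using complex_vector.independentD[OF B(3) B(1) subset_refl _ that] by (simp add: f_def)
  \<comment> \<open>The left side is constantly 1, whereas independence of \<open>B\<close> has made
    the limit 0.\<close>
  have "(\<lambda>n. \<Sum>b\<in>B. cmod (c (r n) b)) \<longlonglongrightarrow> (\<Sum>b\<in>B. cmod (l b))"
    by (intro tendsto_sum tendsto_norm l)
  then show False by (simp add: c1 l0 LIMSEQ_const_iff)
qed

theorem lemma13:
  fixes T P :: "'a::complex_hilbert \<Rightarrow> 'a"
    and S Q :: "nat \<Rightarrow> 'a \<Rightarrow> 'a"
  assumes "separable_space (euclidean :: 'a topology)"
    and "hdim (UNIV :: 'a set) = \<infinity>"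
    and "bounded_clinear T"
    and "\<And>n. n \<ge> 1 \<Longrightarrow> bounded_clinear (S n)"
    and "P \<in> Lat T"
    and "\<And>n. n \<ge> 1 \<Longrightarrow> Q n \<in> Lat (S n)"
    and "bounded_from_below T"
    and "(\<lambda>n. onorm (\<lambda>x. S n x - T x)) \<longlonglongrightarrow> 0"
    and "\<And>x. (\<lambda>n. Q n x) \<longlonglongrightarrow> P x"
  shows "ind T P \<le> liminf (\<lambda>n. ind (S n) (Q n))"
  unfolding le_Liminf_iff
proof (intro allI impI)
  fix y assume y: "y < ind T P"
  then obtain m where m: "y = enat m" by (cases y) auto
  show "\<forall>\<^sub>F n in sequentially. y < ind (S n) (Q n)"
  proof (rule ccontr)
    assume "\<not> ?thesis"
    then have "\<exists>\<^sub>F n in sequentially. \<not> y < ind (S n) (Q n)" by (simp add: not_eventually)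
    \<comment> \<open>The index 0 is excluded because \<open>S\<close> and \<open>Q\<close> are
      constrained only from 1 on.\<close>
    then have "\<exists>\<^sub>F n in sequentially. \<not> y < ind (S n) (Q n) \<and> n \<ge> 1"
      by (rule frequently_eventually_frequently) (rule eventually_ge_at_top)
    then have "infinite {n. \<not> y < ind (S n) (Q n) \<and> n \<ge> 1}"
      by (simp add: frequently_cofinite flip: cofinite_eq_sequentially)
    then obtain r :: "nat \<Rightarrow> nat" where r: "strict_mono r"
      and "\<And>n. r n \<in> {n. \<not> y < ind (S n) (Q n) \<and> n \<ge> 1}"
      using infinite_enumerate by blast
    then have r1: "r n \<ge> 1" and "ind (S (r n)) (Q (r n)) \<le> enat m" for n
      using m by (auto simp: not_less)
    \<comment> \<open>An index at most \<open>m\<close> is below \<open>Suc m\<close>; in the limit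
      this gives \<open>ind T P\<close> at most \<open>m\<close>, against
      \<open>y < ind T P\<close>.\<close>
    then have less: "ind (S (r n)) (Q (r n)) < enat (Suc m)" for n
      by (metis enat_ord_simps(2) lessI order_le_less_trans)
    have "(\<lambda>n. onorm (\<lambda>x. S (r n) x - T x)) \<longlonglongrightarrow> 0"
      using LIMSEQ_subseq_LIMSEQ[OF assms(8) r] by (simp add: o_def)
    moreover have "(\<lambda>n. Q (r n) x) \<longlonglongrightarrow> P x" for x
      using LIMSEQ_subseq_LIMSEQ[OF assms(9) r] by (simp add: o_def)
    ultimately have "ind T P < enat (Suc m)"
      using ind_less_of_limit[where S = "\<lambda>n. S (r n)" and Q = "\<lambda>n. Q (r n)"]
        assms(3) assms(4)[OF r1] assms(5) assms(6)[OF r1] assms(7) less by blast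
    then show False using y m by (cases "ind T P") auto
  qed
qed

end
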